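(* Let $p$ and $q$ be distinct positive integers. Let $A$ be an algebra with a right identity $u$. If $T\in C_{p,q}^J(A)$, then $$T(a)=(a-ua)T(u)+uT(a)$$ for all $a\in A$.
   Context: Algebras are associative, over the complex field. A right identity of $A$ is an element $u\in A$ with $au=a$ for all $a\in A$. An additive map $T:A\to A$ is a $(p,q)$-Jordan centralizer if $(p+q)T(a^2)=pT(a)a+q\,aT(a)$ for all $a\in A$; $C_{p,q}^J(A)$ is the set of all $(p,q)$-Jordan centralizers of $A$. *)

theory Defs
  imports Complex_Main
begin

text \<open>
  The class \<^class>\<open>ring\<close> requires associativity but neither commutativity nor a unit,
  so the algebras below need not be unital.
\<close>

locale complex_algebra = vector_space scale
  for scale :: "complex \<Rightarrow> 'a::ring \<Rightarrow> 'a" (infixr \<open>*\<^sub>C\<close> 75) +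
  assumes scale_mult_left: "(c *\<^sub>C a) * b = c *\<^sub>C (a * b)"
    and scale_mult_right: "a * (c *\<^sub>C b) = c *\<^sub>C (a * b)"
begin

text \<open>
  The integer coefficients \<open>p\<close>, \<open>q\<close> act through the complex scalars. The maps are
  only required to be additive, not complex linear.
\<close>

definition jordan_centralizers :: "nat \<Rightarrow> nat \<Rightarrow> ('a \<Rightarrow> 'a) set" where
  "jordan_centralizers p q =
     {T. Modules.additive T \<and>
         (\<forall>a. of_nat (p + q) *\<^sub>C T (a * a) = of_nat p *\<^sub>C (T a * a) + of_nat q *\<^sub>C (a * T a))}"

end

definition right_identity :: "'a::ring \<Rightarrow> bool" where
  "right_identity u \<longleftrightarrow> (\<forall>a. a * u = a)"

end

theory Submission
  imports Defs
begin

text \<open>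
  Polarising the centralizer identity at the pair \<open>a, u\<close> expresses
  \<open>q T(a) + (p + q) T(u a)\<close> through \<open>T(u)\<close> and \<open>u T(a)\<close>. Multiplying this relation by \<open>u\<close> on the
  left, and substituting \<open>u a\<close> for \<open>a\<close> in it, gives two equations that determine
  \<open>(p + q) T(u a) = p T(u) a + q u a T(u)\<close>. Putting this back into the relation and
  dividing by \<open>q\<close> yields the formula.
\<close>

context complex_algebra
begin

text \<open>Expand the square identity at \<open>a + b\<close> using additivity of \<open>T\<close>;
  the identities at \<open>a\<close> and at \<open>b\<close> cancel and leave the mixed
  terms.\<close>

lemma jordan_centralizer_polarized:
  assumes "T \<in> jordan_centralizers p q"
  shows "of_nat (p + q) *\<^sub>C (T (a * b) + T (b * a)) =
         of_nat p *\<^sub>C (T a * b + T b * a) + of_nat q *\<^sub>C (a * T b + b * T a)"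
proof -
  have add: "T (x + y) = T x + T y" for x y
    using assms by (simp add: jordan_centralizers_def Modules.additive_def)
  have sq: "of_nat (p + q) *\<^sub>C T (x * x) = of_nat p *\<^sub>C (T x * x) + of_nat q *\<^sub>C (x * T x)" for x
    using assms by (simp add: jordan_centralizers_def)
  have "(a + b) * (a + b) = a * a + (a * b + b * a) + b * b"
    by (simp add: distrib_left distrib_right add.assoc)
  with sq[of "a + b"]
  have "of_nat (p + q) *\<^sub>C T (a * a) + of_nat (p + q) *\<^sub>C (T (a * b) + T (b * a))
          + of_nat (p + q) *\<^sub>C T (b * b)
        = of_nat p *\<^sub>C (T a * a + T a * b + T b * a + T b * b)
          + of_nat q *\<^sub>C (a * T a + a * T b + b * T a + b * T b)"
    by (simp add: add distrib_left distrib_right scale_right_distrib add_ac del: of_nat_add)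
  then show ?thesis
    by (simp add: sq scale_right_distrib add_ac del: of_nat_add)
qed

lemma jordan_centralizer_right_identity:
  assumes T: "T \<in> jordan_centralizers p q" and u: "right_identity u" and "q > 0"
  shows "T a = (a - u * a) * T u + u * T a"
proof -
  define P Q :: complex where "P = of_nat p" and "Q = of_nat q"
  have nz: "Q \<noteq> 0" "P + 2 * Q \<noteq> 0"
  proof -
    show "Q \<noteq> 0" using \<open>q > 0\<close> by (simp add: Q_def)
    have "P + 2 * Q = of_nat (p + 2 * q)" by (simp add: P_def Q_def)
    then show "P + 2 * Q \<noteq> 0" using \<open>q > 0\<close> by (simp only: of_nat_eq_0_iff)
  qed
  have r: "x * u = x" for x using u by (simp add: right_identity_def)
  have ru: "x * (u * y) = x * y" for x y by (simp add: r flip: mult.assoc)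
  \<comment> \<open>Since \<open>b * u = b\<close>, the left side of the polarized identity contains
    \<open>(P + Q)\<close> times \<open>T b\<close>; its \<open>P\<close> part cancels against
    \<open>T b * u\<close> on the right.\<close>
  have rel: "Q *\<^sub>C T b + (P + Q) *\<^sub>C T (u * b)
      = P *\<^sub>C (T u * b) + Q *\<^sub>C (b * T u) + Q *\<^sub>C (u * T b)" for b
    using jordan_centralizer_polarized[OF T, of b u]
    by (simp add: r P_def Q_def scale_left_distrib scale_right_distrib add_ac)
  \<comment> \<open>The square identity at \<open>u\<close> itself: as \<open>u * u = u\<close>, the
    \<open>P\<close> terms cancel and \<open>T u\<close> is fixed by left multiplication by
    \<open>u\<close>.\<close>
  have "of_nat (p + q) *\<^sub>C T (u * u) = P *\<^sub>C (T u * u) + Q *\<^sub>C (u * T u)"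
    using T unfolding P_def Q_def jordan_centralizers_def by blast
  then have "Q *\<^sub>C T u = Q *\<^sub>C (u * T u)"
    by (simp add: r P_def Q_def scale_left_distrib)
  then have uTu: "u * T u = T u" using nz by simp
  define X where "X = P *\<^sub>C (T u * a) + Q *\<^sub>C (u * a * T u)"
  have "u * (Q *\<^sub>C T a + (P + Q) *\<^sub>C T (u * a))
      = u * (P *\<^sub>C (T u * a) + Q *\<^sub>C (a * T u) + Q *\<^sub>C (u * T a))"
    by (simp only: rel)
  moreover have "u * (T u * a) = T u * a"
    by (simp add: uTu flip: mult.assoc)
  \<comment> \<open>By \<open>ru\<close>, \<open>u * (u * T a) = u * T a\<close>, so the two terms
    in \<open>u * T a\<close> cancel.\<close>
  ultimately have left: "(P + Q) *\<^sub>C (u * T (u * a)) = X"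
    by (simp add: distrib_left scale_mult_right ru X_def mult.assoc)
  \<comment> \<open>Here \<open>u * (u * a) = u * a\<close>, so both terms on the left of
    \<open>rel\<close> are multiples of \<open>T (u * a)\<close>.\<close>
  have "(P + 2 * Q) *\<^sub>C T (u * a) = X + Q *\<^sub>C (u * T (u * a))"
    using rel[of "u * a"]
    by (simp add: ru X_def mult.assoc scale_left_distrib add_ac flip: scale_left_distrib mult_2)
  \<comment> \<open>Scaling by \<open>P + Q\<close> lets \<open>left\<close> replace the unknown
    \<open>u * T (u * a)\<close> by \<open>X\<close>; the factor \<open>P + 2 * Q\<close> then
    cancels.\<close>
  then have "(P + Q) *\<^sub>C (P + 2 * Q) *\<^sub>C T (u * a)
      = (P + Q) *\<^sub>C X + Q *\<^sub>C (P + Q) *\<^sub>C (u * T (u * a))"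
    by (simp add: scale_right_distrib mult.commute)
  also have "\<dots> = (P + 2 * Q) *\<^sub>C X"
    by (simp add: left flip: scale_left_distrib)
  finally have "(P + 2 * Q) *\<^sub>C (P + Q) *\<^sub>C T (u * a) = (P + 2 * Q) *\<^sub>C X"
    by (simp add: mult.commute)
  then have "(P + Q) *\<^sub>C T (u * a) = X"
    using nz by (simp only: scale_cancel_left) simp
  \<comment> \<open>Both sides contain \<open>P\<close> times \<open>T u * a\<close>, which drops
    out, so every remaining term has the factor \<open>Q\<close>.\<close>
  with rel[of a] have "Q *\<^sub>C T a + Q *\<^sub>C (u * a * T u) = Q *\<^sub>C (a * T u) + Q *\<^sub>C (u * T a)"
    by (simp add: X_def add_ac)
  then have "Q *\<^sub>C (T a + u * a * T u) = Q *\<^sub>C (a * T u + u * T a)"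
    by (simp add: scale_right_distrib)
  then have "T a + u * a * T u = a * T u + u * T a"
    using nz by simp
  then show ?thesis
    by (simp add: left_diff_distrib algebra_simps)
qed

end

theorem theorem5p2:
  fixes scale :: "complex \<Rightarrow> 'a::ring \<Rightarrow> 'a"
    and p q :: nat and u :: 'a and T :: "'a \<Rightarrow> 'a"
  assumes "p > 0" and "q > 0" and "p \<noteq> q"
    and "complex_algebra scale"
    and "right_identity u"
    and "T \<in> complex_algebra.jordan_centralizers scale p q"
  shows "\<forall>a. T a = (a - u * a) * T u + u * T a"
  using complex_algebra.jordan_centralizer_right_identity[OF assms(4,6,5,2)] by blast

end
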